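(* Let $A,B\in M_2$. Suppose that the disc in $\mathbb{C}$ centered at $0$ with radius $$|\operatorname{tr} A|\,r(B_0)+|\operatorname{tr} B|\,r(A_0)+\tfrac12|\operatorname{tr} A||\operatorname{tr} B|$$ lies inside $W_{A_0}(B_0)$. Then $W_A(B)=W_{A\oplus 0}(B\oplus 0)$.
   Context: $M_n$ is the space of $n\times n$ complex matrices and $U_n$ the group of $n\times n$ unitary matrices. For $B\in M_n$, the classical numerical range is $W(B)=\{x^*Bx : x\in\mathbb{C}^n,\ x^*x=1\}$, and the numerical radius is $r(B)=\max_{z\in W(B)}|z|$. For $A,B\in M_n$, the $A$-numerical range of $B$ is $W_A(B)=\{\operatorname{tr}(A\,VBV^* ) : V\in U_n\}$. For $X\in M_2$, $X_0=X-\left(\frac12\operatorname{tr}X\right)I\in M_2$, and $X\oplus 0\in M_3$ denotes the direct sum of $X$ with the $1\times 1$ zero matrix. *)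

theory Defs
  imports "HOL-Analysis.Analysis"
begin

definition conj_transpose :: "complex^'n^'m \<Rightarrow> complex^'m^'n" where
  "conj_transpose A = map_matrix cnj (transpose A)"

definition unitary_matrix :: "complex^'n^'n \<Rightarrow> bool" where
  "unitary_matrix V \<longleftrightarrow> conj_transpose V ** V = mat 1 \<and> V ** conj_transpose V = mat 1"

text \<open>The scalar \<open>x\<^sup>* y\<close>, conjugate-linear in the first argument. The library's \<open>x \<bullet> y\<close>
  is only the real part of it.\<close>
definition sesq :: "complex^'n \<Rightarrow> complex^'n \<Rightarrow> complex" where
  "sesq x y = (\<Sum>i\<in>UNIV. cnj (x $ i) * y $ i)"

definition numerical_range :: "complex^'n^'n \<Rightarrow> complex set" where
  "numerical_range B = {sesq x (B *v x) | x. sesq x x = 1}"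

text \<open>\<open>numerical_range B\<close> is nonempty and compact, so the supremum is a maximum; see
  \<open>numerical_radius_attained\<close> and \<open>cmod_le_numerical_radius\<close> below.\<close>
definition numerical_radius :: "complex^'n^'n \<Rightarrow> real" where
  "numerical_radius B = (SUP z\<in>numerical_range B. cmod z)"

definition A_numerical_range :: "complex^'n^'n \<Rightarrow> complex^'n^'n \<Rightarrow> complex set" where
  "A_numerical_range A B = {trace (A ** (V ** B ** conj_transpose V)) | V. unitary_matrix V}"

text \<open>Here \<open>mat c\<close> is the scalar matrix \<open>c I\<close>.\<close>
definition traceless_part :: "complex^2^2 \<Rightarrow> complex^2^2" where
  "traceless_part X = X - mat (trace X / 2)"

definition oplus_zero :: "complex^2^2 \<Rightarrow> complex^3^3" where
  "oplus_zero X = vector [vector [X $ 1 $ 1, X $ 1 $ 2, 0],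
                          vector [X $ 2 $ 1, X $ 2 $ 2, 0],
                          vector [0, 0, 0]]"

lemma sesq_self: "sesq x x = of_real ((norm x)\<^sup>2)"
proof -
  have "(norm x)\<^sup>2 = (\<Sum>i\<in>UNIV. (cmod (x $ i))\<^sup>2)"
    by (simp add: norm_vec_def L2_set_def sum_nonneg)
  moreover have "sesq x x = (\<Sum>i\<in>UNIV. of_real ((cmod (x $ i))\<^sup>2))"
    unfolding sesq_def
    by (intro sum.cong refl) (simp only: complex_norm_square mult.commute)
  ultimately show ?thesis by simp
qed

lemma numerical_range_eq_image:
  "numerical_range B = (\<lambda>x. sesq x (B *v x)) ` sphere 0 1"
proof -
  have "sesq x x = 1 \<longleftrightarrow> norm x = 1" for x :: "complex^'n"
  proof -
    have "sesq x x = 1 \<longleftrightarrow> (norm x)\<^sup>2 = 1"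
      unfolding sesq_self by (metis of_real_1 of_real_eq_iff)
    also have "\<dots> \<longleftrightarrow> norm x = 1"
      by (metis abs_norm_cancel one_power2 power2_eq_iff_nonneg norm_ge_zero zero_le_one)
    finally show ?thesis .
  qed
  then show ?thesis unfolding numerical_range_def by (force simp: image_iff)
qed

lemma compact_numerical_range: "compact (numerical_range B)"
  unfolding numerical_range_eq_image sesq_def matrix_vector_mult_def
  by (intro compact_continuous_image continuous_intros) auto

lemma numerical_range_nonempty: "numerical_range B \<noteq> {}"
proof -
  have "norm (axis undefined 1 :: complex^'n) = 1" by (simp add: norm_axis_1)
  then show ?thesis unfolding numerical_range_eq_image by auto
qed

lemma cmod_le_numerical_radius:
  assumes "z \<in> numerical_range B"
  shows "cmod z \<le> numerical_radius B"
  unfolding numerical_radius_def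
  using assms compact_numerical_range[of B]
  by (intro cSUP_upper bounded_imp_bdd_above compact_imp_bounded
      compact_continuous_image continuous_intros)

lemma numerical_radius_attained: "\<exists>z\<in>numerical_range B. cmod z = numerical_radius B"
proof -
  obtain z where "z \<in> numerical_range B" "\<forall>w\<in>numerical_range B. cmod w \<le> cmod z"
    using continuous_attains_sup[OF compact_numerical_range numerical_range_nonempty,
        where f = cmod] continuous_on_norm_id by blast
  then show ?thesis
    using cmod_le_numerical_radius numerical_range_nonempty
    unfolding numerical_radius_def by (metis antisym cSUP_least)
qed

end

theory Submission
  imports Defs
begin

text \<open>
  Write \<open>A\<^sub>0\<close>, \<open>B\<^sub>0\<close> for the traceless parts, \<open>\<alpha> = tr A\<close>, \<open>\<beta> = tr B\<close>, and
  \<open>E\<close> for the \<open>A\<^sub>0\<close>-numerical range of \<open>B\<^sub>0\<close>. The \<open>A\<close>-numerical range of \<open>B\<close> is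
  \<open>E + \<alpha>\<beta>/2\<close>, and the argument rests on the convexity of \<open>E\<close>
  (\<open>convex_A_numerical_range_traceless\<close>).

  Convexity: up to unitary similarity \<open>A\<^sub>0\<close> and \<open>B\<^sub>0\<close> have zero diagonal
  (\<open>traceless_similar_hollow\<close>). If their off-diagonal entries are \<open>x, y\<close> and \<open>z, w\<close>, then
  \<open>E\<close> consists of the numbers \<open>x z v + y w v\<^sup>* + y z u + x w u\<^sup>*\<close> with \<open>|u| + |v| = 1\<close>
  (\<open>A_numerical_range_hollow\<close>), where \<open>\<^sup>*\<close> is complex conjugation. Phases can be moved into
  \<open>u\<close>, \<open>v\<close> and a common factor, and exchanging \<open>x\<close> with \<open>y\<close> or \<open>z\<close> with \<open>w\<close> does not change
  the set, so that \<open>x \<ge> y \<ge> 0\<close> and \<open>z \<ge> w \<ge> 0\<close> may be assumed. Then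
  \<open>E\<close> is the union of the Minkowski sums \<open>t C\<^sub>1 + (1 - t) C\<^sub>2\<close> over \<open>0 \<le> t \<le> 1\<close>, where
  \<open>C\<^sub>1\<close>, \<open>C\<^sub>2\<close> are axis-parallel ellipses centred at \<open>0\<close> and the semi-axes of \<open>C\<^sub>2\<close> dominate
  those of \<open>C\<^sub>1\<close>; by the intermediate value theorem this union is the whole elliptical disc
  bounded by \<open>C\<^sub>2\<close> (\<open>ellipse_sums_eq_disc\<close>).

  The larger range: the \<open>A \<oplus> 0\<close>-numerical range of \<open>B \<oplus> 0\<close> consists of the traces \<open>tr (A X B X\<^sup>*)\<close>
  where \<open>X\<close> is the upper left block of a \<open>3 \<times> 3\<close> unitary matrix. As \<open>I - X\<^sup>* X\<close> has rank at
  most one, \<open>X = U diag(1, d) W\<close> with \<open>U\<close>, \<open>W\<close> unitary and \<open>|d| \<le> 1\<close>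
  (\<open>corner_of_unitary_factorization\<close>). Let \<open>p, q\<close> be the upper left entries of \<open>U\<^sup>* A\<^sub>0 U\<close>
  and \<open>W B\<^sub>0 W\<^sup>*\<close>, put \<open>s = |d|\<close>, and let \<open>c\<close> be the contribution of the off-diagonal entries
  when \<open>d\<close> is replaced by its phase. The trace minus \<open>\<alpha>\<beta>/2\<close> equals
  \<open>(1 + s\<^sup>2)/2 (2pq + 2s/(1 + s\<^sup>2) c) + (1 - s\<^sup>2)/2 (p\<beta> + q\<alpha> - \<alpha>\<beta>/2)\<close>.
  Diagonal unitary matrices show \<open>2pq \<plusminus> c \<in> E\<close>, so the first bracket lies in \<open>E\<close> by
  convexity. Since \<open>|p| \<le> r(A\<^sub>0)\<close> and \<open>|q| \<le> r(B\<^sub>0)\<close>, the second bracket lies in the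
  disc of the hypothesis, hence in \<open>E\<close>. By convexity, so does the sum.
\<close>

section \<open>Conjugate transposes and unitary matrices\<close>

lemma conj_transpose_nth [simp]: "conj_transpose A $ i $ j = cnj (A $ j $ i)"
  by (simp add: conj_transpose_def map_matrix_def transpose_def)

lemma conj_transpose_conj_transpose [simp]: "conj_transpose (conj_transpose A) = A"
  by (simp add: vec_eq_iff)

lemma matrix_add_rdistrib:
  fixes A B :: "'a::semiring_1^'n^'m"
  shows "(A + B) ** C = A ** C + B ** C"
  by (simp add: vec_eq_iff matrix_matrix_mult_def distrib_right sum.distrib)

lemma conj_transpose_mult:
  "conj_transpose (A ** B) = conj_transpose B ** conj_transpose A"
  by (simp add: vec_eq_iff matrix_matrix_mult_def mult.commute)

lemma unitary_matrix_conj_transpose: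
  "unitary_matrix U \<Longrightarrow> unitary_matrix (conj_transpose U)"
  by (simp add: unitary_matrix_def)

lemma unitary_matrix_mult:
  assumes "unitary_matrix U" "unitary_matrix V"
  shows "unitary_matrix (U ** V)"
proof -
  have "conj_transpose V ** (conj_transpose U ** U) ** V = mat 1"
    and "U ** (V ** conj_transpose V) ** conj_transpose U = mat 1"
    using assms by (simp_all add: unitary_matrix_def)
  then show ?thesis
    by (simp add: unitary_matrix_def conj_transpose_mult matrix_mul_assoc)
qed

lemma trace_unitary_similar:
  assumes "unitary_matrix U"
  shows "trace (U ** A ** conj_transpose U) = trace A"
proof -
  have "trace (U ** A ** conj_transpose U) = trace (conj_transpose U ** (U ** A))"
    by (rule trace_mul_sym)
  then show ?thesis using assms by (simp add: matrix_mul_assoc unitary_matrix_def)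
qed

lemma A_numerical_range_similar:
  assumes "unitary_matrix U" "unitary_matrix W"
  shows "A_numerical_range (U ** A ** conj_transpose U) (W ** B ** conj_transpose W)
         = A_numerical_range A B"
proof -
  have sub: "A_numerical_range (U ** A ** conj_transpose U) (W ** B ** conj_transpose W)
         \<subseteq> A_numerical_range A B"
    if "unitary_matrix U" "unitary_matrix W" for U W A B
  proof
    fix z assume "z \<in> A_numerical_range (U ** A ** conj_transpose U) (W ** B ** conj_transpose W)"
    then obtain V where V: "unitary_matrix V" and
      z: "z = trace ((U ** A ** conj_transpose U)
                 ** (V ** (W ** B ** conj_transpose W) ** conj_transpose V))"
      unfolding A_numerical_range_def by blast
    let ?V = "conj_transpose U ** V ** W"
    have "z = trace (U ** (A ** conj_transpose U
                 ** (V ** (W ** B ** conj_transpose W) ** conj_transpose V)))"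
      by (simp add: z matrix_mul_assoc)
    also have "\<dots> = trace (A ** conj_transpose U
                 ** (V ** (W ** B ** conj_transpose W) ** conj_transpose V) ** U)"
      by (rule trace_mul_sym)
    also have "\<dots> = trace (A ** (?V ** B ** conj_transpose ?V))"
      by (simp add: conj_transpose_mult matrix_mul_assoc)
    finally have "z = trace (A ** (?V ** B ** conj_transpose ?V))" .
    moreover have "unitary_matrix ?V"
      by (intro unitary_matrix_mult unitary_matrix_conj_transpose that V)
    ultimately show "z \<in> A_numerical_range A B"
      unfolding A_numerical_range_def by blast
  qed
  have inv: "conj_transpose U ** (U ** A ** conj_transpose U) ** conj_transpose (conj_transpose U) = A"
    if "unitary_matrix U" for U A
  proof -
    have "conj_transpose U ** (U ** A ** conj_transpose U) ** conj_transpose (conj_transpose U)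
        = (conj_transpose U ** U) ** A ** (conj_transpose U ** U)"
      by (simp add: matrix_mul_assoc)
    then show ?thesis using that by (simp add: unitary_matrix_def)
  qed
  show ?thesis
    using sub[OF assms, of A B]
      sub[OF unitary_matrix_conj_transpose[OF assms(1)] unitary_matrix_conj_transpose[OF assms(2)],
        of "U ** A ** conj_transpose U" "W ** B ** conj_transpose W"]
    unfolding inv[OF assms(1)] inv[OF assms(2)] by (rule equalityI)
qed

lemma unitary_diagonal_entry_in_numerical_range:
  assumes "unitary_matrix U"
  shows "(conj_transpose U ** M ** U) $ i $ i \<in> numerical_range M"
proof -
  have "sesq (column i U) (column i U) = (conj_transpose U ** U) $ i $ i"
    by (simp add: sesq_def column_def matrix_matrix_mult_def)
  also have "\<dots> = 1" using assms by (simp add: unitary_matrix_def mat_def)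
  finally have "sesq (column i U) (column i U) = 1" .
  moreover have "(conj_transpose U ** M ** U) $ i $ i = sesq (column i U) (M *v column i U)"
    unfolding matrix_mul_assoc[symmetric]
    by (simp add: sesq_def column_def matrix_matrix_mult_def matrix_vector_mult_def)
  ultimately show ?thesis unfolding numerical_range_def by blast
qed

section \<open>Two by two matrices\<close>

text \<open>The two by two matrix with rows \<open>(a, b)\<close> and \<open>(c, d)\<close>.\<close>
definition mat2 :: "'a::zero \<Rightarrow> 'a \<Rightarrow> 'a \<Rightarrow> 'a \<Rightarrow> 'a^2^2" where
  "mat2 a b c d = vector [vector [a, b], vector [c, d]]"

lemma mat2_nth [simp]:
  "mat2 a b c d $ 1 $ 1 = a" "mat2 a b c d $ 1 $ 2 = b"
  "mat2 a b c d $ 2 $ 1 = c" "mat2 a b c d $ 2 $ 2 = d"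
  by (simp_all add: mat2_def)

lemma matrix_eq_2_iff:
  fixes A B :: "'a^2^2"
  shows "A = B \<longleftrightarrow> A $ 1 $ 1 = B $ 1 $ 1 \<and> A $ 1 $ 2 = B $ 1 $ 2
                 \<and> A $ 2 $ 1 = B $ 2 $ 1 \<and> A $ 2 $ 2 = B $ 2 $ 2"
  by (auto simp: vec_eq_iff forall_2)

lemma matrix_mult_nth_2:
  fixes A B :: "'a::semiring_1^2^2"
  shows "(A ** B) $ i $ j = A $ i $ 1 * B $ 1 $ j + A $ i $ 2 * B $ 2 $ j"
  by (simp add: matrix_matrix_mult_def sum_2)

lemma trace_2: "trace (A :: 'a::semiring_1^2^2) = A $ 1 $ 1 + A $ 2 $ 2"
  by (simp add: trace_def sum_2)

lemma mat_nth_2 [simp]: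
  "(mat c :: 'a::zero^2^2) $ 1 $ 1 = c" "(mat c :: 'a^2^2) $ 1 $ 2 = 0"
  "(mat c :: 'a^2^2) $ 2 $ 1 = 0" "(mat c :: 'a^2^2) $ 2 $ 2 = c"
  by (simp_all add: mat_def)

lemma unitary_matrix_2_iff_left:
  fixes U :: "complex^2^2"
  shows "unitary_matrix U \<longleftrightarrow> conj_transpose U ** U = mat 1"
  unfolding unitary_matrix_def using matrix_left_right_inverse by blast

lemma unitary_special:
  assumes "a * cnj a + b * cnj b = 1"
  shows "unitary_matrix (mat2 a b (- cnj b) (cnj a))"
  using assms
  by (simp add: unitary_matrix_2_iff_left matrix_eq_2_iff matrix_mult_nth_2 algebra_simps)

lemma unitary_phase:
  assumes "cmod e = 1"
  shows "unitary_matrix (mat2 1 0 0 e)"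
  using assms complex_norm_square[of e]
  by (simp add: unitary_matrix_2_iff_left matrix_eq_2_iff matrix_mult_nth_2 mult.commute)

lemma ex_unit_vector_orthogonal:
  fixes k l :: complex
  shows "\<exists>a b. a * cnj a + b * cnj b = 1 \<and> a * k + b * l = 0"
proof (cases "k = 0 \<and> l = 0")
  case True
  then show ?thesis by (intro exI[of _ 1] exI[of _ 0]) simp
next
  case False
  define n where "n = sqrt ((cmod k)\<^sup>2 + (cmod l)\<^sup>2)"
  have n0: "n \<noteq> 0" using False by (auto simp: n_def sum_power2_eq_zero_iff)
  have n2: "complex_of_real n * of_real n = k * cnj k + l * cnj l"
    by (simp add: n_def flip: complex_norm_square of_real_mult)
  have "(l / n) * cnj (l / n) + (- k / n) * cnj (- k / n)
      = (k * cnj k + l * cnj l) / (of_real n * of_real n)"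
    by (simp add: add_divide_distrib)
  also have "\<dots> = 1" using n0 by (simp flip: n2)
  finally have "(l / n) * cnj (l / n) + (- k / n) * cnj (- k / n) = 1" .
  then show ?thesis
    by (intro exI[of _ "l / n"] exI[of _ "- k / n"]) (simp add: field_simps)
qed

lemma trace_traceless_part [simp]: "trace (traceless_part A) = 0"
  by (simp add: traceless_part_def trace_2 diff_divide_distrib)

lemma unitary_similar_traceless_part:
  assumes "unitary_matrix V"
  shows "V ** B ** conj_transpose V
       = V ** traceless_part B ** conj_transpose V + mat (trace B / 2)"
proof -
  let ?b = "mat (trace B / 2)"
  have scalar: "V ** ?b = ?b ** V"
    by (simp add: matrix_eq_2_iff matrix_mult_nth_2)
  have "V ** B ** conj_transpose V = V ** (traceless_part B + ?b) ** conj_transpose V"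
    by (simp add: traceless_part_def)
  also have "\<dots> = V ** traceless_part B ** conj_transpose V + ?b ** (V ** conj_transpose V)"
    by (simp add: matrix_add_ldistrib matrix_add_rdistrib scalar matrix_mul_assoc)
  finally show ?thesis using assms by (simp add: unitary_matrix_def)
qed

lemma A_numerical_range_traceless_part:
  "A_numerical_range A B =
     (+) (trace A * trace B / 2) ` A_numerical_range (traceless_part A) (traceless_part B)"
proof -
  have eq: "trace (A ** (V ** B ** conj_transpose V)) = trace A * trace B / 2
       + trace (traceless_part A ** (V ** traceless_part B ** conj_transpose V))"
    if V: "unitary_matrix V" for V
  proof -
    define T where "T = V ** traceless_part B ** conj_transpose V"
    have "T $ 1 $ 1 + T $ 2 $ 2 = 0"
      using trace_unitary_similar[OF V, of "traceless_part B"]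
      unfolding trace_traceless_part T_def by (simp only: trace_2)
    then have T22: "T $ 2 $ 2 = - T $ 1 $ 1" by (simp add: add_eq_0_iff)
    show ?thesis
      unfolding unitary_similar_traceless_part[OF V, of B] T_def[symmetric]
      by (simp add: trace_2 matrix_mult_nth_2 traceless_part_def[of A] T22 field_simps)
  qed
  then show ?thesis unfolding A_numerical_range_def by (auto simp: image_iff) (metis eq)+
qed

section \<open>Convexity for traceless matrices\<close>

lemma traceless_similar_hollow:
  fixes B :: "complex^2^2"
  assumes "trace B = 0"
  shows "\<exists>U z w. unitary_matrix U \<and> U ** B ** conj_transpose U = mat2 0 z w 0"
proof -
  obtain p q r where B: "B = mat2 p q r (- p)"
    using assms that[of "B $ 1 $ 1" "B $ 1 $ 2" "B $ 2 $ 1"]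
    by (simp add: matrix_eq_2_iff trace_2 add_eq_0_iff)
  \<comment> \<open>It suffices to find a vector proportional to \<open>(1, cnj k)\<close> on which the form of \<open>B\<close> vanishes.\<close>
  have "\<exists>k. p + q * cnj k + r * k - p * k * cnj k = 0"
  proof (cases "p = 0")
    case True
    then show ?thesis by (intro exI[of _ 0]) simp
  next
    case False
    define q' r' where "q' = q / p" and "r' = r / p"
    \<comment> \<open>Along \<open>k = t e\<close> with \<open>e\<close> chosen so that \<open>q' e\<^sup>* + r' e\<close> is real, the equation becomes a
       real quadratic equation in \<open>t\<close> whose roots have product \<open>-1\<close>.\<close>
    define m l where "m = Im q' + Im r'" and "l = Re r' - Re q'"
    obtain e where e: "cmod e = 1" and ml: "Re e * m + Im e * l = 0"
    proof (cases "Complex l (- m) = 0")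
      case True
      then show ?thesis using that[of 1] by (simp add: complex_eq_iff)
    next
      case False
      then show ?thesis
        using that[of "sgn (Complex l (- m))"]
        by (simp add: norm_sgn Re_sgn Im_sgn field_simps)
    qed
    define \<mu> where "\<mu> = Re (q' * cnj e + r' * e)"
    have "Im (q' * cnj e + r' * e) = 0"
      using ml by (simp add: m_def l_def algebra_simps)
    then have \<mu>: "q' * cnj e + r' * e = of_real \<mu>"
      by (simp add: \<mu>_def complex_eq_iff)
    define t where "t = (\<mu> + sqrt (\<mu>\<^sup>2 + 4)) / 2"
    have "2 * t - \<mu> = sqrt (\<mu>\<^sup>2 + 4)"
      by (simp add: t_def del: distrib_left_numeral)
    then have "(2 * t - \<mu>)\<^sup>2 = \<mu>\<^sup>2 + 4" by simp
    then have t: "1 + t * \<mu> - t\<^sup>2 = 0" by (simp add: power2_eq_square algebra_simps)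
    let ?k = "of_real t * e"
    have ee: "e * cnj e = 1" using e complex_norm_square[of e] by simp
    have "p + q * cnj ?k + r * ?k - p * ?k * cnj ?k
        = p * (1 + of_real t * (q' * cnj e + r' * e) - (of_real t)\<^sup>2 * (e * cnj e))"
      using False by (simp add: q'_def r'_def field_simps power2_eq_square)
    also have "\<dots> = p * of_real (1 + t * \<mu> - t\<^sup>2)"
      unfolding \<mu> ee by simp
    finally show ?thesis unfolding t by (intro exI[of _ ?k]) simp
  qed
  then obtain k where k: "p + q * cnj k + r * k - p * k * cnj k = 0" by blast
  define n where "n = sqrt (1 + (cmod k)\<^sup>2)"
  have "0 < n" by (simp add: n_def add_pos_nonneg)
  have n2: "(complex_of_real n)\<^sup>2 = 1 + k * cnj k"
    by (simp add: n_def add_nonneg_nonneg flip: complex_norm_square of_real_power)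
  let ?a = "1 / complex_of_real n" and ?b = "k / n"
  let ?U = "mat2 ?a ?b (- cnj ?b) (cnj ?a)"
  have "?a * cnj ?a + ?b * cnj ?b = (1 + k * cnj k) / (of_real n)\<^sup>2"
    by (simp add: add_divide_distrib power2_eq_square)
  also have "\<dots> = 1" using \<open>0 < n\<close> by (simp flip: n2)
  finally have ab: "?a * cnj ?a + ?b * cnj ?b = 1" .
  have "(?U ** B ** conj_transpose ?U) $ 1 $ 1
      = (p + q * cnj k + r * k - p * k * cnj k) / (of_real n)\<^sup>2"
    using \<open>0 < n\<close> by (simp add: B matrix_mult_nth_2 field_simps power2_eq_square)
  then have 11: "(?U ** B ** conj_transpose ?U) $ 1 $ 1 = 0" by (simp add: k)
  have "trace (?U ** B ** conj_transpose ?U) = 0"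
    using trace_unitary_similar[OF unitary_special[OF ab]] assms by simp
  then have "(?U ** B ** conj_transpose ?U) $ 2 $ 2 = 0" unfolding trace_2 11 by simp
  then show ?thesis
    using unitary_special[OF ab] 11
    by (intro exI[of _ ?U] exI[of _ "(?U ** B ** conj_transpose ?U) $ 1 $ 2"]
        exI[of _ "(?U ** B ** conj_transpose ?U) $ 2 $ 1"]) (simp add: matrix_eq_2_iff)
qed

text \<open>The \<open>A\<close>-numerical range of two matrices with zero diagonal and off-diagonal entries
  \<open>x, y\<close> and \<open>z, w\<close>; see \<open>A_numerical_range_hollow\<close>.\<close>
definition hollow_range :: "complex \<Rightarrow> complex \<Rightarrow> complex \<Rightarrow> complex \<Rightarrow> complex set" where
  "hollow_range x y z w =
     {x * z * v + y * w * cnj v + y * z * u + x * w * cnj u | u v. cmod u + cmod v = 1}"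

lemma A_numerical_range_hollow:
  "A_numerical_range (mat2 0 x y 0) (mat2 0 z w 0) = hollow_range x y z w"
proof -
  have tr: "trace (mat2 0 x y 0 ** (V ** mat2 0 z w 0 ** conj_transpose V))
      = x * z * (V$2$1 * cnj (V$1$2)) + y * w * cnj (V$2$1 * cnj (V$1$2))
        + y * z * (V$1$1 * cnj (V$2$2)) + x * w * cnj (V$1$1 * cnj (V$2$2))" for V
    by (simp add: trace_2 matrix_mult_nth_2 algebra_simps)
  show ?thesis
  proof (intro equalityI subsetI)
    fix t assume "t \<in> A_numerical_range (mat2 0 x y 0) (mat2 0 z w 0)"
    then obtain V where V: "unitary_matrix V"
      and t: "t = trace (mat2 0 x y 0 ** (V ** mat2 0 z w 0 ** conj_transpose V))"
      unfolding A_numerical_range_def by blast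
    have "complex_of_real ((cmod (V$1$1))\<^sup>2 + (cmod (V$2$1))\<^sup>2) = 1"
      "complex_of_real ((cmod (V$1$1))\<^sup>2 + (cmod (V$1$2))\<^sup>2) = 1"
      "complex_of_real ((cmod (V$1$2))\<^sup>2 + (cmod (V$2$2))\<^sup>2) = 1"
      using V by (simp_all add: unitary_matrix_def matrix_eq_2_iff matrix_mult_nth_2
          complex_norm_square mult.commute del: of_real_power)
    then have n: "(cmod (V$1$1))\<^sup>2 + (cmod (V$2$1))\<^sup>2 = 1"
      "(cmod (V$1$1))\<^sup>2 + (cmod (V$1$2))\<^sup>2 = 1"
      "(cmod (V$1$2))\<^sup>2 + (cmod (V$2$2))\<^sup>2 = 1"
      by (simp_all only: of_real_eq_1_iff)
    from n have "(cmod (V$1$2))\<^sup>2 = (cmod (V$2$1))\<^sup>2" "(cmod (V$2$2))\<^sup>2 = (cmod (V$1$1))\<^sup>2"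
      by linarith+
    then have "cmod (V$1$2) = cmod (V$2$1)" "cmod (V$2$2) = cmod (V$1$1)"
      by (simp_all only: power2_eq_iff_nonneg norm_ge_zero)
    then have "cmod (V$1$1 * cnj (V$2$2)) + cmod (V$2$1 * cnj (V$1$2)) = 1"
      using n(1) by (simp add: norm_mult power2_eq_square)
    then show "t \<in> hollow_range x y z w" unfolding hollow_range_def t tr by blast
  next
    fix t assume "t \<in> hollow_range x y z w"
    then obtain u v where uv: "cmod u + cmod v = 1"
      and t: "t = x * z * v + y * w * cnj v + y * z * u + x * w * cnj u"
      unfolding hollow_range_def by blast
    \<comment> \<open>For the matrix \<open>V\<close> below, the products in the trace formula are
       \<open>V$1$1 * cnj (V$2$2) = a\<^sup>2\<close> and \<open>V$2$1 * cnj (V$1$2) = - b\<^sup>2\<close>.\<close>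
    define a b where "a = csqrt u" and "b = csqrt (- v)"
    let ?V = "mat2 a (- cnj b) b (cnj a)"
    have ab: "a * a = u" "b * b = - v"
      by (simp_all add: a_def b_def flip: power2_eq_square)
    have "(cmod a)\<^sup>2 + (cmod b)\<^sup>2 = 1"
      using uv ab by (metis norm_minus_cancel norm_mult power2_eq_square)
    then have "a * cnj a + b * cnj b = 1"
      by (metis complex_norm_square of_real_1 of_real_add)
    then have "unitary_matrix ?V"
      by (intro unitary_special[of a "- cnj b", simplified]) (simp add: mult.commute)
    moreover have "trace (mat2 0 x y 0 ** (?V ** mat2 0 z w 0 ** conj_transpose ?V)) = t"
      unfolding tr t using ab
      by (simp add: ab flip: complex_cnj_mult)
    ultimately show "t \<in> A_numerical_range (mat2 0 x y 0) (mat2 0 z w 0)"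
      unfolding A_numerical_range_def by blast
  qed
qed

text \<open>Here \<open>\<lambda>u. Complex (p1 * Re u) (p2 * Im u)\<close> maps circles about \<open>0\<close> to ellipses with
  semi-axes proportional to \<open>|p1|\<close> and \<open>|p2|\<close>.\<close>
lemma ellipse_sums_eq_disc:
  fixes p1 p2 q1 q2 :: real
  assumes "\<bar>p1\<bar> \<le> q1" "\<bar>p2\<bar> \<le> q2"
  shows "{Complex (q1 * Re v + p1 * Re u) (q2 * Im v + p2 * Im u) | u v. cmod u + cmod v = 1}
       = (\<lambda>v. Complex (q1 * Re v) (q2 * Im v)) ` cball 0 1"
proof -
  \<comment> \<open>If \<open>q1 = 0\<close> then \<open>p1 = 0\<close>, so the value \<open>p1 / 0 = 0\<close> is the right one.\<close>
  define M where "M u = Complex (p1 / q1 * Re u) (p2 / q2 * Im u)" for u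
  have q: "q1 * (p1 / q1 * a) = p1 * a" "q2 * (p2 / q2 * a) = p2 * a" for a
    using assms by auto
  have c: "(p1 / q1)\<^sup>2 \<le> 1" "(p2 / q2)\<^sup>2 \<le> 1"
    using assms by (auto simp: abs_square_le_1 divide_le_eq_1)
  have M: "cmod (M u) \<le> cmod u" for u
    unfolding cmod_def M_def using mult_right_mono[OF c(1), of "(Re u)\<^sup>2"]
      mult_right_mono[OF c(2), of "(Im u)\<^sup>2"]
    by (simp add: power_mult_distrib power_divide)
  show ?thesis
  proof (intro equalityI subsetI)
    fix z assume "z \<in> {Complex (q1 * Re v + p1 * Re u) (q2 * Im v + p2 * Im u) | u v.
        cmod u + cmod v = 1}"
    then obtain u v where uv: "cmod u + cmod v = 1"
      and z: "z = Complex (q1 * Re v + p1 * Re u) (q2 * Im v + p2 * Im u)" by blast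
    have "cmod (v + M u) \<le> 1"
      using uv M[of u] norm_triangle_ineq[of v "M u"] by linarith
    moreover have "z = Complex (q1 * Re (v + M u)) (q2 * Im (v + M u))"
      by (simp add: z M_def distrib_left q del: times_divide_eq_left)
    ultimately show "z \<in> (\<lambda>v. Complex (q1 * Re v) (q2 * Im v)) ` cball 0 1"
      by (intro image_eqI[of _ _ "v + M u"]) auto
  next
    fix z assume "z \<in> (\<lambda>v. Complex (q1 * Re v) (q2 * Im v)) ` cball 0 1"
    then obtain v where v: "cmod v \<le> 1" and z: "z = Complex (q1 * Re v) (q2 * Im v)" by auto
    \<comment> \<open>The pair \<open>(t, v - t M 1)\<close> yields \<open>z\<close> for every \<open>t\<close>; choose \<open>t\<close> to normalize it.\<close>
    define f where "f t = \<bar>t\<bar> + cmod (v - of_real t * M 1)" for t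
    have "continuous_on {0..1} f" unfolding f_def by (intro continuous_intros)
    moreover have "f 0 \<le> 1" "1 \<le> f 1" using v by (simp_all add: f_def)
    ultimately obtain t where t: "0 \<le> t" "f t = 1"
      using IVT'[of f 0 1 1] by auto
    let ?u = "complex_of_real t" and ?v = "v - of_real t * M 1"
    have "cmod ?u + cmod ?v = 1" using t by (simp add: f_def)
    moreover have "z = Complex (q1 * Re ?v + p1 * Re ?u) (q2 * Im ?v + p2 * Im ?u)"
      using q(1)[of t] by (simp add: z M_def algebra_simps)
    ultimately show "z \<in> {Complex (q1 * Re v + p1 * Re u) (q2 * Im v + p2 * Im u) | u v.
        cmod u + cmod v = 1}" by blast
  qed
qed

lemma hollow_range_swap:
  "hollow_range y x z w = hollow_range x y z w"
  "hollow_range x y w z = hollow_range x y z w"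
proof -
  have "hollow_range y x z w \<subseteq> hollow_range x y z w" for x y z w
    
  proof
    fix t assume "t \<in> hollow_range y x z w"
    then obtain u v where "cmod u + cmod v = 1"
      and "t = y * z * v + x * w * cnj v + x * z * u + y * w * cnj u"
      unfolding hollow_range_def by blast
    then show "t \<in> hollow_range x y z w"
      unfolding hollow_range_def
      by (intro CollectI exI[of _ v] exI[of _ u]) (simp add: algebra_simps)
  qed
  then show "hollow_range y x z w = hollow_range x y z w" by blast
  have "hollow_range x y w z \<subseteq> hollow_range x y z w" for x y z w
  proof
    fix t assume "t \<in> hollow_range x y w z"
    then obtain u v where "cmod u + cmod v = 1"
      and "t = x * w * v + y * z * cnj v + y * w * u + x * z * cnj u"
      unfolding hollow_range_def by blast
    then show "t \<in> hollow_range x y z w"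
      unfolding hollow_range_def
      by (intro CollectI exI[of _ "cnj v"] exI[of _ "cnj u"]) (simp add: algebra_simps)
  qed
  then show "hollow_range x y w z = hollow_range x y z w" by blast
qed

lemma convex_hollow_range_real:
  fixes x y z w :: real
  assumes "0 \<le> x" "0 \<le> y" "0 \<le> z" "0 \<le> w"
  shows "convex (hollow_range x y z w)"
proof -
  have ordered: "convex (hollow_range x y z w)"
    if "0 \<le> y" "y \<le> x" "0 \<le> w" "w \<le> z" for x y z w :: real
  proof -
    let ?q1 = "x * z + y * w" and ?q2 = "x * z - y * w"
    let ?p1 = "y * z + x * w" and ?p2 = "y * z - x * w"
    have "0 \<le> (x - y) * (z - w)" "0 \<le> (x + y) * (z - w)" "0 \<le> (x - y) * (z + w)"
      "0 \<le> y * z" "0 \<le> x * w"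
      using that by simp_all
    then have le: "\<bar>?p1\<bar> \<le> ?q1" "\<bar>?p2\<bar> \<le> ?q2"
      by (simp_all add: abs_le_iff algebra_simps)
    have "x * z * v + y * w * cnj v + y * z * u + x * w * cnj u
        = Complex (?q1 * Re v + ?p1 * Re u) (?q2 * Im v + ?p2 * Im u)" for u v :: complex
      by (simp add: complex_eq_iff algebra_simps)
    then have "hollow_range x y z w = (\<lambda>v. Complex (?q1 * Re v) (?q2 * Im v)) ` cball 0 1"
      unfolding hollow_range_def ellipse_sums_eq_disc[OF le, symmetric] by simp
    moreover have "linear (\<lambda>v. Complex (?q1 * Re v) (?q2 * Im v))"
      by (rule linearI) (simp_all add: complex_eq_iff algebra_simps)
    ultimately show ?thesis by (simp add: convex_linear_image)
  qed
  have "convex (hollow_range x y z w)" if "0 \<le> y" "y \<le> x" "0 \<le> z" "0 \<le> w" for x y z w :: real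
    using ordered[of y x w z] ordered[of y x z w] that
    by (cases "w \<le> z") (simp_all add: hollow_range_swap(2)[of x y w z])
  from this[of y x z w] this[of x y z w] show ?thesis
    using assms by (cases "y \<le> x") (simp_all add: hollow_range_swap(1)[of y x z w])
qed

text \<open>Replacing \<open>v\<close> and \<open>u\<close> by suitable unimodular multiples turns the four phases into one
  common factor. One choice for \<open>v\<close> and one for \<open>u\<close> suffice, since both pairs of
  coefficients \<open>x z, y w\<close> and \<open>y z, x w\<close> have the same product.\<close>
lemma hollow_range_phases:
  "hollow_range (r1 * cis a) (r2 * cis b) (r3 * cis c) (r4 * cis d)
     = (*) (cis ((a + b + c + d) / 2)) ` hollow_range r1 r2 r3 r4"
proof -
  let ?\<theta> = "cis ((b + d - a - c) / 2)" and ?\<psi> = "cis ((a + d - b - c) / 2)"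
  let ?h = "cis ((a + b + c + d) / 2)"
  have ph: "cis a * cis c * ?\<theta> = ?h" "cis b * cis d * cnj ?\<theta> = ?h"
    "cis b * cis c * ?\<psi> = ?h" "cis a * cis d * cnj ?\<psi> = ?h"
    by (simp_all add: cis_mult cis_cnj field_simps)
  have val: "(r1 * cis a) * (r3 * cis c) * (?\<theta> * v) + (r2 * cis b) * (r4 * cis d) * cnj (?\<theta> * v)
      + (r2 * cis b) * (r3 * cis c) * (?\<psi> * u) + (r1 * cis a) * (r4 * cis d) * cnj (?\<psi> * u)
     = ?h * (r1 * r3 * v + r2 * r4 * cnj v + r2 * r3 * u + r1 * r4 * cnj u)" for u v
  proof -
    have "(r1 * cis a) * (r3 * cis c) * (?\<theta> * v) + (r2 * cis b) * (r4 * cis d) * cnj (?\<theta> * v)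
      + (r2 * cis b) * (r3 * cis c) * (?\<psi> * u) + (r1 * cis a) * (r4 * cis d) * cnj (?\<psi> * u)
      = r1 * r3 * v * (cis a * cis c * ?\<theta>) + r2 * r4 * cnj v * (cis b * cis d * cnj ?\<theta>)
      + r2 * r3 * u * (cis b * cis c * ?\<psi>) + r1 * r4 * cnj u * (cis a * cis d * cnj ?\<psi>)"
      by (simp only: complex_cnj_mult mult_ac)
    then show ?thesis unfolding ph by (simp add: algebra_simps)
  qed
  show ?thesis
  proof (intro equalityI subsetI)
    fix t assume "t \<in> hollow_range (r1 * cis a) (r2 * cis b) (r3 * cis c) (r4 * cis d)"
    then obtain u v where uv: "cmod u + cmod v = 1"
      and t: "t = (r1 * cis a) * (r3 * cis c) * v + (r2 * cis b) * (r4 * cis d) * cnj v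
      + (r2 * cis b) * (r3 * cis c) * u + (r1 * cis a) * (r4 * cis d) * cnj u"
      unfolding hollow_range_def by blast
    let ?u = "cnj ?\<psi> * u" and ?v = "cnj ?\<theta> * v"
    have "?\<theta> * ?v = v" "?\<psi> * ?u = u"
      by (simp_all add: cis_cnj cis_mult flip: mult.assoc)
    then have "t = ?h * (r1 * r3 * ?v + r2 * r4 * cnj ?v + r2 * r3 * ?u + r1 * r4 * cnj ?u)"
      using val[of ?v ?u] unfolding t by metis
    moreover have "cmod ?u + cmod ?v = 1" using uv by (simp add: norm_mult)
    ultimately show "t \<in> (*) ?h ` hollow_range r1 r2 r3 r4"
      unfolding hollow_range_def by blast
  next
    fix t assume "t \<in> (*) ?h ` hollow_range r1 r2 r3 r4"
    then obtain u v where uv: "cmod u + cmod v = 1"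
      and t: "t = ?h * (r1 * r3 * v + r2 * r4 * cnj v + r2 * r3 * u + r1 * r4 * cnj u)"
      unfolding hollow_range_def by blast
    then show "t \<in> hollow_range (r1 * cis a) (r2 * cis b) (r3 * cis c) (r4 * cis d)"
      unfolding t hollow_range_def val[symmetric]
      by (intro CollectI exI[of _ "?\<psi> * u"] exI[of _ "?\<theta> * v"]) (simp add: norm_mult)
  qed
qed

lemma convex_hollow_range: "convex (hollow_range x y z w)"
proof -
  have "convex (hollow_range (cmod x * cis (Arg x)) (cmod y * cis (Arg y))
      (cmod z * cis (Arg z)) (cmod w * cis (Arg w)))"
    unfolding hollow_range_phases
    by (intro convex_linear_image convex_hollow_range_real bounded_linear.linear
        bounded_linear_mult_right) simp_all
  then show ?thesis by (simp add: rcis_cmod_Arg flip: rcis_def)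
qed

lemma convex_A_numerical_range_traceless:
  fixes A B :: "complex^2^2"
  assumes "trace A = 0" "trace B = 0"
  shows "convex (A_numerical_range A B)"
proof -
  obtain U x y where U: "unitary_matrix U" "U ** A ** conj_transpose U = mat2 0 x y 0"
    using traceless_similar_hollow[OF assms(1)] by blast
  obtain W z w where W: "unitary_matrix W" "W ** B ** conj_transpose W = mat2 0 z w 0"
    using traceless_similar_hollow[OF assms(2)] by blast
  show ?thesis
    using A_numerical_range_similar[OF U(1) W(1), of A B] convex_hollow_range[of x y z w]
    by (simp add: U(2) W(2) A_numerical_range_hollow)
qed

section \<open>Corners of three by three unitary matrices\<close>

text \<open>The upper left two by two block, which is all that \<open>A \<oplus> 0\<close> and \<open>B \<oplus> 0\<close> see of a
  unitary matrix.\<close>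
definition corner :: "'a^3^3 \<Rightarrow> 'a::zero^2^2" where
  "corner V = mat2 (V $ 1 $ 1) (V $ 1 $ 2) (V $ 2 $ 1) (V $ 2 $ 2)"

lemma trace_oplus_zero:
  "trace (oplus_zero A ** (V ** oplus_zero B ** conj_transpose V))
     = trace (A ** (corner V ** B ** conj_transpose (corner V)))"
  by (simp add: trace_def matrix_matrix_mult_def sum_2 sum_3 oplus_zero_def corner_def)

lemma unitary_extend:
  assumes "unitary_matrix V"
  obtains V' :: "complex^3^3" where "unitary_matrix V'" "corner V' = V"
proof -
  let ?V = "vector [vector [V $ 1 $ 1, V $ 1 $ 2, 0], vector [V $ 2 $ 1, V $ 2 $ 2, 0],
      vector [0, 0, 1]] :: complex^3^3"
  have "unitary_matrix ?V"
    using assms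
    by (simp add: unitary_matrix_def vec_eq_iff forall_2 forall_3 matrix_matrix_mult_def
        sum_2 sum_3 mat_def)
  moreover have "corner ?V = V" by (simp add: corner_def matrix_eq_2_iff)
  ultimately show ?thesis using that by blast
qed

text \<open>A singular value decomposition in which one singular value is \<open>1\<close>, except that the
  second diagonal entry \<open>d\<close> is allowed to be complex.\<close>
lemma corner_of_unitary_factorization:
  assumes "unitary_matrix V"
  obtains U W d where "unitary_matrix U" "unitary_matrix W" "cmod d \<le> 1"
    "corner V = U ** mat2 1 0 0 d ** W"
proof -
  let ?X = "corner V"
  define k l where "k = cnj (V $ 3 $ 1)" and "l = cnj (V $ 3 $ 2)"
  \<comment> \<open>\<open>I - X\<^sup>* X\<close> is the rank one matrix built from the vector \<open>(k, l)\<close>, and the first column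
     of \<open>W\<^sup>*\<close> is chosen orthogonal to that vector.\<close>
  obtain a b where ab: "a * cnj a + b * cnj b = 1" and orth: "a * k + b * l = 0"
    using ex_unit_vector_orthogonal by blast
  let ?W = "mat2 a b (- cnj b) (cnj a)"
  have W: "unitary_matrix ?W" using ab by (rule unitary_special)
  define \<kappa> where "\<kappa> = cnj a * l - cnj b * k"
  have "conj_transpose V ** V = mat 1" using assms by (simp add: unitary_matrix_def)
  then have XX: "conj_transpose ?X ** ?X
      = mat 1 - mat2 (k * cnj k) (k * cnj l) (l * cnj k) (l * cnj l)"
    by (simp add: vec_eq_iff forall_2 forall_3 matrix_matrix_mult_def sum_2 sum_3 mat_def
        corner_def k_def l_def algebra_simps)
  define Z where "Z = ?X ** conj_transpose ?W"
  have "conj_transpose Z ** Z = ?W ** (conj_transpose ?X ** ?X) ** conj_transpose ?W"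
    by (simp add: Z_def conj_transpose_mult matrix_mul_assoc)
  also have "\<dots> = mat2 1 0 0 (1 - \<kappa> * cnj \<kappa>)"
  proof -
    have "cnj a * cnj k + cnj b * cnj l = 0"
      using arg_cong[OF orth, of cnj] by simp
    then show ?thesis
      unfolding XX using ab orth
      by (simp add: matrix_eq_2_iff matrix_mult_nth_2 \<kappa>_def) algebra
  qed
  finally have ZZ: "conj_transpose Z ** Z = mat2 1 0 0 (1 - \<kappa> * cnj \<kappa>)" .
  define f g d where "f = Z $ 1 $ 1" and "g = Z $ 2 $ 1" and "d = f * Z $ 2 $ 2 - g * Z $ 1 $ 2"
  have fg: "f * cnj f + g * cnj g = 1" and col: "cnj f * Z $ 1 $ 2 + cnj g * Z $ 2 $ 2 = 0"
    and norm2: "cnj (Z $ 1 $ 2) * Z $ 1 $ 2 + cnj (Z $ 2 $ 2) * Z $ 2 $ 2 = 1 - \<kappa> * cnj \<kappa>"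
    using ZZ by (simp_all add: matrix_eq_2_iff matrix_mult_nth_2 f_def g_def mult.commute)
  let ?U = "mat2 f (- cnj g) g (cnj f)"
  have U: "unitary_matrix ?U"
    using unitary_special[of f "- cnj g"] fg by (simp add: mult.commute)
  have Z12: "Z $ 1 $ 2 = - cnj g * d" and Z22: "Z $ 2 $ 2 = cnj f * d"
    using fg col unfolding d_def by algebra+
  have "d * cnj d = 1 - \<kappa> * cnj \<kappa>"
    using norm2 fg unfolding Z12 Z22 by simp algebra
  then have "complex_of_real ((cmod d)\<^sup>2) = of_real (1 - (cmod \<kappa>)\<^sup>2)"
    by (simp add: complex_norm_square del: of_real_power)
  then have "(cmod d)\<^sup>2 \<le> 1" by (simp only: of_real_eq_iff) simp
  then have d: "cmod d \<le> 1" by (simp add: power_le_one_iff abs_square_le_1)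
  have "?X = Z ** ?W"
    using W by (simp add: Z_def unitary_matrix_def flip: matrix_mul_assoc)
  also have "Z = ?U ** mat2 1 0 0 d"
    by (simp add: matrix_eq_2_iff matrix_mult_nth_2 Z12 Z22 f_def g_def)
  finally show ?thesis using that U W d by blast
qed

section \<open>The two ranges agree\<close>

lemma A_numerical_range_subset_oplus_zero:
  "A_numerical_range A B \<subseteq> A_numerical_range (oplus_zero A) (oplus_zero B)"
proof
  fix z assume "z \<in> A_numerical_range A B"
  then obtain V where "unitary_matrix V" and z: "z = trace (A ** (V ** B ** conj_transpose V))"
    unfolding A_numerical_range_def by blast
  then obtain V' :: "complex^3^3" where "unitary_matrix V'" "corner V' = V"
    using unitary_extend by blast
  then show "z \<in> A_numerical_range (oplus_zero A) (oplus_zero B)"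
    unfolding A_numerical_range_def z by (auto simp: trace_oplus_zero intro!: exI[of _ V'])
qed

text \<open>The case in which the corner is diagonal, to which the factorization of the corner reduces
  the general one. Here \<open>p, q\<close> and \<open>x, y, z, w\<close> are the entries of the traceless parts, and \<open>\<alpha>, \<beta>\<close>
  the traces of the two matrices.\<close>
lemma diagonal_corner_value:
  fixes \<alpha> \<beta> p q x y z w d :: complex
  defines "E \<equiv> A_numerical_range (mat2 p x y (- p)) (mat2 q z w (- q))"
  assumes disc: "p * \<beta> + q * \<alpha> - \<alpha> * \<beta> / 2 \<in> E" and d: "cmod d \<le> 1"
  shows "(p + \<alpha> / 2) * (q + \<beta> / 2) + d * cnj d * (p - \<alpha> / 2) * (q - \<beta> / 2)
           + x * w * d + y * z * cnj d - \<alpha> * \<beta> / 2 \<in> E"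
proof -
  have convE: "convex E"
    unfolding E_def by (rule convex_A_numerical_range_traceless) (simp_all add: trace_2)
  define s e where "s = cmod d" and "e = cis (Arg d)"
  have s: "0 \<le> s" "s \<le> 1" using d by (simp_all add: s_def)
  have de: "d = of_real s * e" by (simp add: s_def e_def rcis_cmod_Arg flip: rcis_def)
  have e: "cmod e = 1" by (simp add: e_def)
  define c where "c = x * w * e + y * z * cnj e"
  have phase: "2 * p * q + (x * w * \<epsilon> + y * z * cnj \<epsilon>) \<in> E" if "cmod \<epsilon> = 1" for \<epsilon>
  proof -
    have "trace (mat2 p x y (- p) ** (mat2 1 0 0 \<epsilon> ** mat2 q z w (- q)
            ** conj_transpose (mat2 1 0 0 \<epsilon>))) = p * q * (1 + \<epsilon> * cnj \<epsilon>) + (x * w * \<epsilon> + y * z * cnj \<epsilon>)"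
      by (simp add: trace_2 matrix_mult_nth_2 algebra_simps)
    also have "\<epsilon> * cnj \<epsilon> = 1" using that complex_norm_square[of \<epsilon>] by simp
    finally show ?thesis
      unfolding E_def A_numerical_range_def using unitary_phase[OF that] by force
  qed
  have plus: "2 * p * q + c \<in> E" using phase[OF e] by (simp add: c_def)
  have minus: "2 * p * q - c \<in> E"
    using phase[of "- e"] e by (simp add: c_def algebra_simps)
  define t where "t = 2 * s / (1 + s\<^sup>2)"
  have s1: "0 < 1 + s\<^sup>2" by (simp add: add_pos_nonneg)
  have t: "0 \<le> t" "t \<le> 1"
    using s s1 sum_squares_bound[of s 1] by (simp_all add: t_def divide_le_eq_1)
  have "((1 + t) / 2) *\<^sub>R (2 * p * q + c) + ((1 - t) / 2) *\<^sub>R (2 * p * q - c) \<in> E"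
    using convE plus minus t by (intro convexD) (simp_all add: field_simps)
  also have "((1 + t) / 2) *\<^sub>R (2 * p * q + c) + ((1 - t) / 2) *\<^sub>R (2 * p * q - c)
      = 2 * p * q + t * c"
    by (simp add: scaleR_conv_of_real field_simps)
  finally have "((1 + s\<^sup>2) / 2) *\<^sub>R (2 * p * q + t * c)
      + ((1 - s\<^sup>2) / 2) *\<^sub>R (p * \<beta> + q * \<alpha> - \<alpha> * \<beta> / 2) \<in> E"
    using convE disc s by (intro convexD) (simp_all add: field_simps power_le_one)
  also have "((1 + s\<^sup>2) / 2) *\<^sub>R (2 * p * q + t * c) = (1 + s\<^sup>2) * p * q + s * c"
  proof -
    have "(1 + s\<^sup>2) / 2 * t = s" using s1 by (simp add: t_def)
    then have "complex_of_real ((1 + s\<^sup>2) / 2) * t = s" by (metis of_real_mult)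
    then show ?thesis by (simp add: scaleR_conv_of_real distrib_left flip: mult.assoc)
  qed
  also have "(1 + s\<^sup>2) * p * q + s * c + ((1 - s\<^sup>2) / 2) *\<^sub>R (p * \<beta> + q * \<alpha> - \<alpha> * \<beta> / 2)
     = (p + \<alpha> / 2) * (q + \<beta> / 2) + s\<^sup>2 * (p - \<alpha> / 2) * (q - \<beta> / 2) + s * c - \<alpha> * \<beta> / 2"
    by (simp add: scaleR_conv_of_real field_simps)
  also have "complex_of_real (s\<^sup>2) = d * cnj d" unfolding s_def by (rule complex_norm_square)
  also have "s * c = x * w * d + y * z * cnj d" by (simp add: c_def de algebra_simps)
  finally show ?thesis by (simp add: add.assoc)
qed

theorem theorem8:
  fixes A B :: "complex^2^2"
  assumes "cball 0 (cmod (trace A) * numerical_radius (traceless_part B)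
                  + cmod (trace B) * numerical_radius (traceless_part A)
                  + cmod (trace A) * cmod (trace B) / 2)
           \<subseteq> A_numerical_range (traceless_part A) (traceless_part B)"
  shows "A_numerical_range A B = A_numerical_range (oplus_zero A) (oplus_zero B)"
proof (rule equalityI[OF A_numerical_range_subset_oplus_zero subsetI])
  fix \<zeta> assume "\<zeta> \<in> A_numerical_range (oplus_zero A) (oplus_zero B)"
  then obtain V :: "complex^3^3" where V: "unitary_matrix V"
    and "\<zeta> = trace (oplus_zero A ** (V ** oplus_zero B ** conj_transpose V))"
    unfolding A_numerical_range_def by blast
  then have \<zeta>: "\<zeta> = trace (A ** (corner V ** B ** conj_transpose (corner V)))"
    by (simp add: trace_oplus_zero)
  obtain U W d where U: "unitary_matrix U" and W: "unitary_matrix W" and d: "cmod d \<le> 1"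
    and X: "corner V = U ** mat2 1 0 0 d ** W"
    using corner_of_unitary_factorization[OF V] by blast
  let ?A = "traceless_part A" and ?B = "traceless_part B" and ?D = "mat2 1 0 0 d"
  define \<alpha> \<beta> where "\<alpha> = trace A" and "\<beta> = trace B"
  define A1 B1 where "A1 = conj_transpose U ** ?A ** U" and "B1 = W ** ?B ** conj_transpose W"
  have U': "unitary_matrix (conj_transpose U)" using U by (rule unitary_matrix_conj_transpose)
  have "trace A1 = 0" using trace_unitary_similar[OF U', of ?A] by (simp add: A1_def)
  then obtain p x y where A1: "A1 = mat2 p x y (- p)"
    using that[of "A1 $ 1 $ 1" "A1 $ 1 $ 2" "A1 $ 2 $ 1"]
    by (simp add: matrix_eq_2_iff trace_2 add_eq_0_iff)
  have "trace B1 = 0" using trace_unitary_similar[OF W, of ?B] by (simp add: B1_def)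
  then obtain q z w where B1: "B1 = mat2 q z w (- q)"
    using that[of "B1 $ 1 $ 1" "B1 $ 1 $ 2" "B1 $ 2 $ 1"]
    by (simp add: matrix_eq_2_iff trace_2 add_eq_0_iff)
  let ?E = "A_numerical_range ?A ?B"
  have E: "?E = A_numerical_range (mat2 p x y (- p)) (mat2 q z w (- q))"
    using A_numerical_range_similar[OF U' W, of ?A ?B]
    by (simp add: A1_def[symmetric] B1_def[symmetric] A1 B1)
  have "cmod p \<le> numerical_radius ?A"
    using unitary_diagonal_entry_in_numerical_range[OF U, of ?A 1]
    by (intro cmod_le_numerical_radius) (simp add: A1_def[symmetric] A1)
  moreover have "cmod q \<le> numerical_radius ?B"
    using unitary_diagonal_entry_in_numerical_range[OF unitary_matrix_conj_transpose[OF W], of ?B 1]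
    by (intro cmod_le_numerical_radius) (simp add: B1_def[symmetric] B1)
  moreover have "cmod (p * \<beta> + q * \<alpha> - \<alpha> * \<beta> / 2)
      \<le> cmod \<alpha> * cmod q + cmod \<beta> * cmod p + cmod \<alpha> * cmod \<beta> / 2"
    using norm_triangle_ineq4[of "p * \<beta> + q * \<alpha>" "\<alpha> * \<beta> / 2"]
      norm_triangle_ineq[of "p * \<beta>" "q * \<alpha>"]
    by (simp add: norm_mult norm_divide mult.commute)
  ultimately have "cmod (p * \<beta> + q * \<alpha> - \<alpha> * \<beta> / 2)
      \<le> cmod \<alpha> * numerical_radius ?B + cmod \<beta> * numerical_radius ?A + cmod \<alpha> * cmod \<beta> / 2"
    by (smt (verit) mult_left_mono norm_ge_zero)
  then have disc: "p * \<beta> + q * \<alpha> - \<alpha> * \<beta> / 2 \<in> ?E"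
    using assms unfolding \<alpha>_def \<beta>_def by (auto simp: subset_iff)
  have AU: "conj_transpose U ** A ** U = mat2 (p + \<alpha> / 2) x y (- p + \<alpha> / 2)"
    using unitary_similar_traceless_part[OF U', of A]
    by (simp add: A1_def[symmetric] A1 \<alpha>_def[symmetric] matrix_eq_2_iff)
  have BW: "W ** B ** conj_transpose W = mat2 (q + \<beta> / 2) z w (- q + \<beta> / 2)"
    using unitary_similar_traceless_part[OF W, of B]
    by (simp add: B1_def[symmetric] B1 \<beta>_def[symmetric] matrix_eq_2_iff)
  have "\<zeta> = trace ((A ** U) ** (?D ** (W ** B ** conj_transpose W) ** conj_transpose ?D
      ** conj_transpose U))"
    unfolding \<zeta> X by (simp add: conj_transpose_mult matrix_mul_assoc)
  also have "\<dots> = trace ((conj_transpose U ** A ** U)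
      ** (?D ** (W ** B ** conj_transpose W) ** conj_transpose ?D))"
    by (metis trace_mul_sym matrix_mul_assoc)
  also have "\<dots> = (p + \<alpha> / 2) * (q + \<beta> / 2) + d * cnj d * (p - \<alpha> / 2) * (q - \<beta> / 2)
           + x * w * d + y * z * cnj d"
    unfolding AU BW by (simp add: trace_2 matrix_mult_nth_2 field_simps)
  finally have "\<zeta> - \<alpha> * \<beta> / 2 \<in> ?E"
    using diagonal_corner_value[OF disc[unfolded E] d] by (simp add: E)
  then show "\<zeta> \<in> A_numerical_range A B"
    unfolding A_numerical_range_traceless_part[of A B] \<alpha>_def \<beta>_def
    by (rule image_eqI[rotated]) simp
qed

end
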